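(* For every $\theta\in\mathbb{R}^n$ one can construct, by perturbing the round sphere, a $\rho_\theta$-symmetric (i.e. $\rho_\theta$-invariant) starshaped domain $K$ in $\mathbb{R}^{2n}$ such that $$\mathfrak{R}(\partial K,\rho_\theta)>1 .$$
   Context: Identify $\mathbb{C}^n$ with $\mathbb{R}^{2n}$ via $z_j=x_j+iy_j$ and let $\lambda_0=\tfrac12\sum_{j=1}^n(x_j\,dy_j-y_j\,dx_j)$. For $\theta=(\theta_1,\dots,\theta_n)\in\mathbb{R}^n$ set $\rho_\theta(z)=(e^{i\theta_1}\overline{z}_1,\dots,e^{i\theta_n}\overline{z}_n)$; this is an involution with $\rho_\theta^*\lambda_0=-\lambda_0$. Starshaped domains are compact domains with smooth boundary that are starshaped with respect to the origin, the radial vector field being transverse to the boundary; then $\alpha=\lambda_0|_{\partial K}$ is a contact form on $\partial K$. For a contact form $\alpha$ on a closed connected manifold $\Sigma$, the Reeb vector field $R$ is determined by $d\alpha(R,\cdot)=0$, $\alpha(R)=1$. A periodic orbit of period $\tau>0$ is a smooth curve $\gamma:\mathbb{R}/\tau\mathbb{Z}\to\Sigma$ with $\dot\gamma=R\circ\gamma$. If $\rho$ is an involution of $\Sigma$ with $\rho^*\alpha=-\alpha$, a periodic orbit $\gamma$ is called symmetric if $\rho(\mathrm{Im}(\gamma))=\mathrm{Im}(\gamma)$. The systole $\ell_{\min}$ is the infimum of the periods of all periodic orbits, the symmetric systole $\ell_{\min}^{\mathrm{sym}}$ is the infimum of the periods of all symmetric periodic orbits (the infimum of the empty set is $\infty$),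 and the symmetric ratio is $\mathfrak{R}=\ell_{\min}^{\mathrm{sym}}/\ell_{\min}$. Here $\mathfrak{R}(\partial K,\rho_\theta)$ is the symmetric ratio for $\Sigma=\partial K$, $\alpha=\lambda_0|_{\partial K}$, $\rho=\rho_\theta|_{\partial K}$.
   Formalization: The formal theorem assumes n ≥ 2; for n = 1 the claim is false, since the boundary of K is a single closed curve whose only simple periodic orbit is symmetric, so the symmetric ratio is always 1. *)

theory Defs
  imports "HOL-Analysis.Analysis"
begin

text \<open>Iterated differentiability; these notions are only used on open sets.\<close>

fun Ck_on :: "nat \<Rightarrow> 'a::euclidean_space set \<Rightarrow> ('a \<Rightarrow> 'b::real_normed_vector) \<Rightarrow> bool" where
  "Ck_on 0 S f \<longleftrightarrow> continuous_on S f"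
| "Ck_on (Suc k) S f \<longleftrightarrow>
     (\<forall>x\<in>S. f differentiable (at x)) \<and> (\<forall>v. Ck_on k S (\<lambda>x. frechet_derivative f (at x) v))"

definition smooth_on :: "'a::euclidean_space set \<Rightarrow> ('a \<Rightarrow> 'b::real_normed_vector) \<Rightarrow> bool" where
  "smooth_on S f \<longleftrightarrow> (\<forall>k. Ck_on k S f)"

definition tangent_space :: "'a::euclidean_space set \<Rightarrow> 'a \<Rightarrow> 'a set" where
  "tangent_space S p =
     {v. \<exists>c \<epsilon>. 0 < \<epsilon> \<and> smooth_on {-\<epsilon><..<\<epsilon>} c \<and> (\<forall>t\<in>{-\<epsilon><..<\<epsilon>}. c t \<in> S) \<and>
           c 0 = p \<and> (c has_vector_derivative v) (at (0::real))}"

definition smooth_boundary :: "'a::euclidean_space set \<Rightarrow> bool" where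
  "smooth_boundary K \<longleftrightarrow>
     (\<forall>p\<in>frontier K. \<exists>U (g :: 'a \<Rightarrow> real). open U \<and> p \<in> U \<and> smooth_on U g \<and>
        (\<forall>x\<in>U. \<exists>v. frechet_derivative g (at x) v \<noteq> 0) \<and> K \<inter> U = {x\<in>U. g x \<le> 0})"

text \<open>The radial vector field has the value \<open>p\<close> at the point \<open>p\<close>, so transversality to the
  hypersurface \<open>frontier K\<close> says that \<open>p\<close> is not a tangent vector at \<open>p\<close>.\<close>

definition starshaped_domain :: "'a::euclidean_space set \<Rightarrow> bool" where
  "starshaped_domain K \<longleftrightarrow> compact K \<and> smooth_boundary K \<and>
     0 \<in> K \<and> (\<forall>x\<in>K. closed_segment 0 x \<subseteq> K) \<and>
     (\<forall>p\<in>frontier K. p \<notin> tangent_space (frontier K) p)"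

text \<open>A 1-form \<open>\<alpha>\<close> on the ambient space is given by \<open>\<alpha> p v\<close>, linear in \<open>v\<close>. Contact forms on a
  hypersurface are restrictions of ambient 1-forms, and exterior derivatives commute with
  restriction, so only values on tangent vectors of the hypersurface enter below.\<close>

definition ext_deriv :: "('a::euclidean_space \<Rightarrow> 'a \<Rightarrow> real) \<Rightarrow> 'a \<Rightarrow> 'a \<Rightarrow> 'a \<Rightarrow> real" where
  "ext_deriv \<alpha> p u v =
     frechet_derivative (\<lambda>x. \<alpha> x v) (at p) u - frechet_derivative (\<lambda>x. \<alpha> x u) (at p) v"

definition is_Reeb_vector ::
    "('a::euclidean_space \<Rightarrow> 'a \<Rightarrow> real) \<Rightarrow> 'a set \<Rightarrow> 'a \<Rightarrow> 'a \<Rightarrow> bool" where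
  "is_Reeb_vector \<alpha> S p R \<longleftrightarrow> R \<in> tangent_space S p \<and>
     (\<forall>v\<in>tangent_space S p. ext_deriv \<alpha> p R v = 0) \<and> \<alpha> p R = 1"

text \<open>Maps from the circle of length \<open>\<tau>\<close> are \<open>\<tau>\<close>-periodic maps on the reals;
  \<open>\<tau>\<close> need not be the minimal period.\<close>

definition periodic_orbit ::
    "('a::euclidean_space \<Rightarrow> 'a \<Rightarrow> real) \<Rightarrow> 'a set \<Rightarrow> real \<Rightarrow> (real \<Rightarrow> 'a) \<Rightarrow> bool" where
  "periodic_orbit \<alpha> S \<tau> \<gamma> \<longleftrightarrow> 0 < \<tau> \<and> smooth_on UNIV \<gamma> \<and> (\<forall>t. \<gamma> (t + \<tau>) = \<gamma> t) \<and>
     (\<forall>t. \<gamma> t \<in> S \<and> is_Reeb_vector \<alpha> S (\<gamma> t) (vector_derivative \<gamma> (at t)))"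

definition symmetric_periodic_orbit ::
    "('a::euclidean_space \<Rightarrow> 'a \<Rightarrow> real) \<Rightarrow> 'a set \<Rightarrow> ('a \<Rightarrow> 'a) \<Rightarrow> real \<Rightarrow> (real \<Rightarrow> 'a) \<Rightarrow> bool" where
  "symmetric_periodic_orbit \<alpha> S \<rho> \<tau> \<gamma> \<longleftrightarrow> periodic_orbit \<alpha> S \<tau> \<gamma> \<and> \<rho> ` range \<gamma> = range \<gamma>"

definition systole :: "('a::euclidean_space \<Rightarrow> 'a \<Rightarrow> real) \<Rightarrow> 'a set \<Rightarrow> ennreal" where
  "systole \<alpha> S = (INF \<tau>\<in>{\<tau>. \<exists>\<gamma>. periodic_orbit \<alpha> S \<tau> \<gamma>}. ennreal \<tau>)"

definition symmetric_systole ::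
    "('a::euclidean_space \<Rightarrow> 'a \<Rightarrow> real) \<Rightarrow> 'a set \<Rightarrow> ('a \<Rightarrow> 'a) \<Rightarrow> ennreal" where
  "symmetric_systole \<alpha> S \<rho> = (INF \<tau>\<in>{\<tau>. \<exists>\<gamma>. symmetric_periodic_orbit \<alpha> S \<rho> \<tau> \<gamma>}. ennreal \<tau>)"

definition symmetric_ratio ::
    "('a::euclidean_space \<Rightarrow> 'a \<Rightarrow> real) \<Rightarrow> 'a set \<Rightarrow> ('a \<Rightarrow> 'a) \<Rightarrow> ennreal" where
  "symmetric_ratio \<alpha> S \<rho> = symmetric_systole \<alpha> S \<rho> / systole \<alpha> S"

definition lambda0 :: "complex ^ 'n \<Rightarrow> complex ^ 'n \<Rightarrow> real" where
  "lambda0 z v = (\<Sum>j\<in>UNIV. Re (z $ j) * Im (v $ j) - Im (z $ j) * Re (v $ j)) / 2"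

definition rho :: "real ^ 'n \<Rightarrow> complex ^ 'n \<Rightarrow> complex ^ 'n" where
  "rho \<theta> z = (\<chi> j. cis (\<theta> $ j) * cnj (z $ j))"

text \<open>A smooth family of domains \<open>K s\<close>, \<open>\<bar>s\<bar> < \<delta>\<close>, with \<open>K 0\<close> the closed unit ball: each \<open>K s\<close>
  is the region under a positive radial function \<open>r s\<close> on the unit sphere. Smoothness in \<open>(s, u)\<close>
  is expressed on an open neighbourhood of the sphere. In particular \<open>r s\<close> tends to \<open>1\<close> in all
  derivatives, uniformly on the sphere, as \<open>s\<close> tends to \<open>0\<close>.\<close>

definition round_sphere_perturbation :: "real \<Rightarrow> (real \<Rightarrow> 'a::euclidean_space set) \<Rightarrow> bool" where
  "round_sphere_perturbation \<delta> K \<longleftrightarrow> 0 < \<delta> \<and>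
     (\<exists>(r :: real \<Rightarrow> 'a \<Rightarrow> real) V. open V \<and> sphere 0 1 \<subseteq> V \<and>
        smooth_on ({-\<delta><..<\<delta>} \<times> V) (\<lambda>(s, u). r s u) \<and>
        (\<forall>u\<in>sphere 0 1. r 0 u = 1) \<and>
        (\<forall>s\<in>{-\<delta><..<\<delta>}. (\<forall>u\<in>sphere 0 1. 0 < r s u) \<and>
           K s = {t *\<^sub>R u | t u. u \<in> sphere 0 1 \<and> 0 \<le> t \<and> t \<le> r s u}))"

end

theory Submission
  imports Defs
begin

text \<open>
  With \<open>q z = (\<Sum>j. exp (- \<i> \<theta>\<^sub>j) z\<^sub>j\<^sup>2)\<close> the function
  \<open>H s z = (1 + s) |z|\<^sup>4 - s |q z|\<^sup>2\<close> is homogeneous of degree 4, invariant under \<open>\<rho>\<close> and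
  under the Hopf circle action, and \<open>K s = {H s \<le> 1}\<close>. Its Reeb field is half the Hamiltonian field
  of \<open>H s\<close>. Since \<open>|q z| \<le> |z|\<^sup>2\<close>, with equality over the fixed points of \<open>\<rho>\<close>, the function \<open>|q|\<^sup>2\<close> on
  the sphere is extremal there and on the zero set of \<open>q\<close>, so the Hopf circles over both sets are
  closed orbits, of periods \<open>\<pi>\<close> and \<open>\<pi> / sqrt (1 + s)\<close> respectively. As \<open>\<rho>\<close> reverses the flow, a symmetric
  orbit meets the fixed point set of \<open>\<rho>\<close> and therefore is one of the circles of period \<open>\<pi>\<close>.
\<close>

section \<open>Calculus of iterated differentiability and smooth maps\<close>

lemma frechet_derivative_eq:
  "(f has_derivative f') (at x) \<Longrightarrow> frechet_derivative f (at x) = f'"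
  by (metis frechet_derivative_at)

text \<open>On an open set the derivative at a point sees only values inside the set, so agreement
  passes to all iterated derivatives.\<close>

lemma Ck_on_cong:
  assumes "open S" "\<And>x. x \<in> S \<Longrightarrow> f x = g x"
  shows "Ck_on k S f \<longleftrightarrow> Ck_on k S g"
  using assms(2)
proof (induction k arbitrary: f g)
  case 0
  then show ?case by (simp cong: continuous_on_cong)
next
  case (Suc k)
  have *: "(f has_derivative D) (at x) \<longleftrightarrow> (g has_derivative D) (at x)" if "x \<in> S" for x D
    using has_derivative_transform_within_open[OF _ assms(1) that] Suc.prems by metis
  have d: "f differentiable (at x) \<longleftrightarrow> g differentiable (at x)" if "x \<in> S" for x
    using *[OF that] by (simp add: differentiable_def)
  have "frechet_derivative f (at x) = frechet_derivative g (at x)" if "x \<in> S" for x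
    unfolding frechet_derivative_def using *[OF that] by simp
  then have "Ck_on k S (\<lambda>x. frechet_derivative f (at x) v) \<longleftrightarrow>
      Ck_on k S (\<lambda>x. frechet_derivative g (at x) v)" for v
    by (intro Suc.IH) simp
  then show ?case using d by simp
qed

lemma Ck_on_subset: "Ck_on k T f \<Longrightarrow> S \<subseteq> T \<Longrightarrow> Ck_on k S f"
proof (induction k arbitrary: f)
  case 0
  then show ?case by (auto intro: continuous_on_subset)
next
  case (Suc k)
  then have "Ck_on k S (\<lambda>x. frechet_derivative f (at x) v)" for v by simp
  then show ?case using Suc.prems by (auto simp only: Ck_on.simps)
qed

text \<open>An explicit derivative formula \<open>f'\<close> may stand in for the choice-based
  \<open>frechet_derivative\<close>; most closure rules below go through this.\<close>

lemma Ck_on_SucI: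
  assumes "open S" "\<And>x. x \<in> S \<Longrightarrow> (f has_derivative f' x) (at x)"
    and "\<And>v. Ck_on k S (\<lambda>x. f' x v)"
  shows "Ck_on (Suc k) S f"
proof -
  have "Ck_on k S (\<lambda>x. frechet_derivative f (at x) v)" for v
    using assms(3)[of v]
    by (subst Ck_on_cong[OF assms(1), where g = "\<lambda>x. f' x v"])
      (simp_all add: frechet_derivative_eq[OF assms(2)])
  then show ?thesis using assms(2) by (auto simp: differentiable_def)
qed

lemma Ck_on_SucD:
  assumes "Ck_on (Suc k) S f"
  shows "\<And>x. x \<in> S \<Longrightarrow> (f has_derivative frechet_derivative f (at x)) (at x)"
    and "\<And>v. Ck_on k S (\<lambda>x. frechet_derivative f (at x) v)"
  using assms by (auto simp: frechet_derivative_works)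

text \<open>The product and chain rules leave some factors undifferentiated; this lowers their order
  to that of the induction hypothesis.\<close>

lemma Ck_on_Suc_imp: "Ck_on (Suc k) S f \<Longrightarrow> Ck_on k S f"
proof (induction k arbitrary: f)
  case 0
  then show ?case
    by (auto intro!: continuous_at_imp_continuous_on differentiable_imp_continuous_within)
next
  case (Suc k)
  then show ?case by (metis Ck_on.simps(2))
qed

lemma Ck_on_const: "Ck_on k S (\<lambda>_. c)"
  by (induction k arbitrary: c) (auto simp: frechet_derivative_const)

lemma Ck_on_bounded_linear:
  assumes "open S" "bounded_linear L" "Ck_on k S f"
  shows "Ck_on k S (\<lambda>x. L (f x))"
  using assms(3)
proof (induction k arbitrary: f)
  case 0
  then show ?case
    using bounded_linear.continuous_on[OF assms(2)] by auto
next
  case (Suc k)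
  note D = Ck_on_SucD[OF Suc.prems]
  show ?case
    by (rule Ck_on_SucI[OF assms(1) bounded_linear.has_derivative[OF assms(2) D(1)] Suc.IH[OF D(2)]])
qed

lemma Ck_on_ident: "open S \<Longrightarrow> Ck_on k S (\<lambda>x. x)"
proof (cases k)
  case (Suc m)
  assume "open S"
  then show ?thesis
    unfolding Suc by (rule Ck_on_SucI[OF _ has_derivative_ident Ck_on_const])
qed auto

lemma Ck_on_add:
  assumes "open S" "Ck_on k S f" "Ck_on k S g"
  shows "Ck_on k S (\<lambda>x. f x + g x)"
  using assms(2,3)
proof (induction k arbitrary: f g)
  case 0
  then show ?case by (simp add: continuous_on_add)
next
  case (Suc k)
  note D = Ck_on_SucD[OF Suc.prems(1)] and E = Ck_on_SucD[OF Suc.prems(2)]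
  show ?case
    by (rule Ck_on_SucI[OF assms(1) has_derivative_add[OF D(1) E(1)] Suc.IH[OF D(2) E(2)]])
qed

lemma Ck_on_bounded_bilinear:
  assumes "open S" "bounded_bilinear B" "Ck_on k S f" "Ck_on k S g"
  shows "Ck_on k S (\<lambda>x. B (f x) (g x))"
  using assms(3,4)
proof (induction k arbitrary: f g)
  case 0
  then show ?case using bounded_bilinear.continuous_on[OF assms(2)] by auto
next
  case (Suc k)
  note D = Ck_on_SucD[OF Suc.prems(1)] and E = Ck_on_SucD[OF Suc.prems(2)]
  show ?case
  proof (rule Ck_on_SucI[OF assms(1) bounded_bilinear.FDERIV[OF assms(2) D(1) E(1)]])
    show "Ck_on k S (\<lambda>x. B (f x) (frechet_derivative g (at x) v) +
        B (frechet_derivative f (at x) v) (g x))" for v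
      by (rule Ck_on_add[OF assms(1) Suc.IH Suc.IH])
        (rule Suc.prems[THEN Ck_on_Suc_imp] D(2) E(2))+
  qed
qed

text \<open>Differentiation lowers the exponent by one, so the induction runs over all exponents at
  once. Positivity of \<open>g\<close> keeps the power away from its singularity at 0.\<close>

lemma Ck_on_powr:
  fixes g :: "'a::euclidean_space \<Rightarrow> real"
  assumes "open S" "Ck_on k S g" "\<And>x. x \<in> S \<Longrightarrow> 0 < g x"
  shows "Ck_on k S (\<lambda>x. g x powr a)"
  using assms(2)
proof (induction k arbitrary: a)
  case 0
  then show ?case using assms(3) by (force intro!: continuous_on_powr continuous_on_const)
next
  case (Suc k)
  note D = Ck_on_SucD[OF Suc.prems]
  have "((\<lambda>x. g x powr a) has_derivative
      (\<lambda>v. a *\<^sub>R (g x powr (a - 1) * frechet_derivative g (at x) v))) (at x)" if "x \<in> S" for x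
    using DERIV_compose_FDERIV[OF has_real_derivative_powr[OF assms(3)[OF that]] D(1)[OF that]]
    by (simp add: mult_ac)
  moreover have "Ck_on k S (\<lambda>x. a *\<^sub>R (g x powr (a - 1) * frechet_derivative g (at x) v))" for v
    by (rule Ck_on_bounded_linear[OF assms(1) bounded_linear_scaleR_right
          Ck_on_bounded_bilinear[OF assms(1) bounded_bilinear_mult
            Suc.IH[OF Ck_on_Suc_imp[OF Suc.prems]] D(2)]])
  ultimately show ?case by (rule Ck_on_SucI[OF assms(1)])
qed

text \<open>The derivative has the same shape with new coefficient vectors, so the induction
  generalizes over \<open>a\<close> and \<open>b\<close>.\<close>

lemma Ck_on_rotation: "Ck_on k UNIV (\<lambda>t. cos (\<omega> * t) *\<^sub>R a + sin (\<omega> * t) *\<^sub>R b)"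
proof (induction k arbitrary: a b)
  case 0
  then show ?case by (simp add: continuous_intros)
next
  case (Suc k)
  have "((\<lambda>t. cos (\<omega> * t) *\<^sub>R a + sin (\<omega> * t) *\<^sub>R b) has_derivative
      (\<lambda>v. cos (\<omega> * t) *\<^sub>R ((v * \<omega>) *\<^sub>R b) + sin (\<omega> * t) *\<^sub>R ((- (v * \<omega>)) *\<^sub>R a))) (at t)" for t
    by (auto intro!: derivative_eq_intros simp: algebra_simps)
  then show ?case by (rule Ck_on_SucI[OF open_UNIV _ Suc.IH])
qed

lemma smooth_on_const: "smooth_on S (\<lambda>_. c)"
  by (simp add: smooth_on_def Ck_on_const)

lemma smooth_on_ident: "open S \<Longrightarrow> smooth_on S (\<lambda>x. x)"
  by (simp add: smooth_on_def Ck_on_ident)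

lemma smooth_on_bounded_linear:
  "open S \<Longrightarrow> bounded_linear L \<Longrightarrow> smooth_on S f \<Longrightarrow> smooth_on S (\<lambda>x. L (f x))"
  by (simp add: smooth_on_def Ck_on_bounded_linear)

lemma smooth_on_add:
  "open S \<Longrightarrow> smooth_on S f \<Longrightarrow> smooth_on S g \<Longrightarrow> smooth_on S (\<lambda>x. f x + g x)"
  by (simp add: smooth_on_def Ck_on_add)

lemma smooth_on_bounded_bilinear:
  "open S \<Longrightarrow> bounded_bilinear B \<Longrightarrow> smooth_on S f \<Longrightarrow> smooth_on S g \<Longrightarrow>
    smooth_on S (\<lambda>x. B (f x) (g x))"
  by (simp add: smooth_on_def Ck_on_bounded_bilinear)

lemma smooth_on_powr:
  fixes g :: "'a::euclidean_space \<Rightarrow> real"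
  shows "open S \<Longrightarrow> smooth_on S g \<Longrightarrow> (\<And>x. x \<in> S \<Longrightarrow> 0 < g x) \<Longrightarrow> smooth_on S (\<lambda>x. g x powr a)"
  by (simp add: smooth_on_def Ck_on_powr)

lemma smooth_on_rotation: "smooth_on UNIV (\<lambda>t. cos (\<omega> * t) *\<^sub>R a + sin (\<omega> * t) *\<^sub>R b)"
  by (simp add: smooth_on_def Ck_on_rotation)

lemma smooth_on_imp_differentiable: "smooth_on S f \<Longrightarrow> x \<in> S \<Longrightarrow> f differentiable (at x)"
  unfolding smooth_on_def by (metis Ck_on.simps(2))

text \<open>Any open neighbourhood of 0 shrinks to the symmetric interval that
  \<open>tangent_space\<close> asks for.\<close>

lemma tangent_spaceI:
  assumes "open T" "0 \<in> T" "smooth_on T c" "\<And>t. t \<in> T \<Longrightarrow> c t \<in> S" "c 0 = p"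
    "(c has_vector_derivative v) (at (0::real))"
  shows "v \<in> tangent_space S p"
proof -
  obtain e where "0 < e" "ball 0 e \<subseteq> T"
    using assms(1,2) openE by blast
  then have T: "{-e<..<e} \<subseteq> T" by (simp add: ball_eq_greaterThanLessThan)
  have "smooth_on {-e<..<e} c"
    using assms(3) Ck_on_subset T unfolding smooth_on_def by blast
  moreover have "\<forall>t\<in>{-e<..<e}. c t \<in> S" using T assms(4) by blast
  ultimately show ?thesis
    unfolding tangent_space_def using \<open>0 < e\<close> assms(5,6) by (intro CollectI exI conjI)
qed

section \<open>Uniqueness for ordinary differential equations\<close>

text \<open>Gronwall argument: \<open>h\<close>, the squared distance weighted by
  \<open>exp (- (2 * L) * t)\<close>, is nonincreasing and vanishes at \<open>a\<close>. The
  Lipschitz bound is asked for only along the two curves because the field it is applied to is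
  cubic.\<close>

lemma ode_unique_forward:
  fixes X :: "'a::euclidean_space \<Rightarrow> 'a"
  assumes f: "\<And>t. (f has_vector_derivative X (f t)) (at t)"
    and g: "\<And>t. (g has_vector_derivative X (g t)) (at t)"
    and L: "\<And>t. norm (X (f t) - X (g t)) \<le> L * norm (f t - g t)"
    and "f a = g a" "a \<le> t"
  shows "f t = g t"
proof -
  define h where "h t = exp (- (2 * L) * t) * ((f t - g t) \<bullet> (f t - g t))" for t
  have d: "((\<lambda>t. f t - g t) has_derivative (\<lambda>x. x *\<^sub>R (X (f t) - X (g t)))) (at t)" for t
    using has_vector_derivative_diff[OF f g] by (simp add: has_vector_derivative_def)
  have "(h has_real_derivative exp (- (2 * L) * t) *
      (2 * ((f t - g t) \<bullet> (X (f t) - X (g t))) - 2 * L * ((f t - g t) \<bullet> (f t - g t)))) (at t)" for t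
    unfolding h_def has_field_derivative_def
    by (rule derivative_eq_intros d refl)+ (simp add: fun_eq_iff algebra_simps inner_commute)
  moreover have "(f t - g t) \<bullet> (X (f t) - X (g t)) \<le> L * ((f t - g t) \<bullet> (f t - g t))" for t
  proof -
    have "(f t - g t) \<bullet> (X (f t) - X (g t)) \<le> norm (f t - g t) * (L * norm (f t - g t))"
      using norm_cauchy_schwarz[of "f t - g t" "X (f t) - X (g t)"]
        mult_left_mono[OF L[of t] norm_ge_zero[of "f t - g t"]] by linarith
    also have "\<dots> = L * ((f t - g t) \<bullet> (f t - g t))" by (simp add: dot_square_norm power2_eq_square)
    finally show ?thesis .
  qed
  ultimately have "h t \<le> h a"
    using \<open>a \<le> t\<close> by (intro DERIV_nonpos_imp_nonincreasing[of a t h]) 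
      (auto intro!: exI conjI mult_nonneg_nonpos)
  also have "h a = 0" using assms(4) by (simp add: h_def)
  finally show ?thesis by (simp add: h_def mult_le_0_iff dot_square_norm)
qed

text \<open>For times before \<open>a\<close>, both curves are reversed; they then solve the
  equation of \<open>- X\<close>, and forward uniqueness applies from \<open>- a\<close>.\<close>

lemma ode_unique:
  fixes X :: "'a::euclidean_space \<Rightarrow> 'a"
  assumes f: "\<And>t. (f has_vector_derivative X (f t)) (at t)"
    and g: "\<And>t. (g has_vector_derivative X (g t)) (at t)"
    and L: "\<And>t. norm (X (f t) - X (g t)) \<le> L * norm (f t - g t)"
    and a: "f a = g a"
  shows "f t = g t"
proof (cases "a \<le> t")
  case True
  show ?thesis by (rule ode_unique_forward[OF f g L a True])
next
  case False
  have *: "((\<lambda>t. h (- t)) has_vector_derivative - X (h (- t))) (at t)"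
    if "\<And>t. (h has_vector_derivative X (h t)) (at t)" for h and t :: real
    using vector_diff_chain_at[OF has_vector_derivative_minus[OF has_vector_derivative_id] that, of t]
    by (simp add: o_def)
  have "f (- (- t)) = g (- (- t))"
    using False a
    by (intro ode_unique_forward[OF *[OF f] *[OF g], of L "- a" "- t"])
      (simp_all add: L norm_minus_commute[of "X (g _)"])
  then show ?thesis by simp
qed

lemma ennreal_inverse_antimono: "a \<le> b \<Longrightarrow> inverse b \<le> inverse (a :: ennreal)"
  unfolding less_eq_ennreal.rep_eq inverse_ennreal.rep_eq
  by (rule ereal_inverse_antimono) simp_all

section \<open>Smooth products, a Lipschitz bound for cubic maps, and quarter powers\<close>

lemma smooth_on_mult:
  fixes f g :: "'a::euclidean_space \<Rightarrow> real"
  shows "open S \<Longrightarrow> smooth_on S f \<Longrightarrow> smooth_on S g \<Longrightarrow> smooth_on S (\<lambda>x. f x * g x)"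
  by (rule smooth_on_bounded_bilinear[OF _ bounded_bilinear_mult])

lemma smooth_on_inner:
  fixes f g :: "'a::euclidean_space \<Rightarrow> 'b::euclidean_space"
  shows "open S \<Longrightarrow> smooth_on S f \<Longrightarrow> smooth_on S g \<Longrightarrow> smooth_on S (\<lambda>x. f x \<bullet> g x)"
  by (rule smooth_on_bounded_bilinear[OF _ bounded_bilinear_inner])

lemma smooth_on_minus: "open S \<Longrightarrow> smooth_on S f \<Longrightarrow> smooth_on S (\<lambda>x. - f x)"
  by (rule smooth_on_bounded_linear[OF _ bounded_linear_minus[OF bounded_linear_ident]])

lemma smooth_on_diff: "open S \<Longrightarrow> smooth_on S f \<Longrightarrow> smooth_on S g \<Longrightarrow> smooth_on S (\<lambda>x. f x - g x)"
  using smooth_on_add[OF _ _ smooth_on_minus, of S f g] by simp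

text \<open>The difference telescopes into three terms, each with \<open>x - y\<close> in one of the
  three linear slots. On the unit ball each term is at most \<open>norm (x - y)\<close>, hence the
  factor 3.\<close>

lemma norm_quadratic_times_linear_diff_le:
  fixes A B :: "'a::euclidean_space \<Rightarrow> 'a"
  assumes "linear A" "linear B" "\<And>x. norm (A x) = norm x" "\<And>x. norm (B x) = norm x"
    and "norm x \<le> 1" "norm y \<le> 1"
  shows "norm ((A x \<bullet> x) *\<^sub>R B x - (A y \<bullet> y) *\<^sub>R B y) \<le> 3 * norm (x - y)"
proof -
  let ?d = "norm (x - y)"
  have *: "\<bar>u \<bullet> v\<bar> \<le> a * b" if "norm u \<le> a" "norm v \<le> b" for u v :: 'a and a b
    using Cauchy_Schwarz_ineq2[of u v] mult_mono[OF that] that norm_ge_zero[of u] norm_ge_zero[of v]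
    by linarith
  have "norm ((A x \<bullet> x) *\<^sub>R B (x - y)) \<le> 1 * ?d"
    unfolding norm_scaleR assms(4) using *[of "A x" 1 x 1] assms
    by (intro mult_right_mono) auto
  moreover have "norm ((A (x - y) \<bullet> x) *\<^sub>R B y) \<le> ?d * 1"
    unfolding norm_scaleR assms(4) using *[of "A (x - y)" ?d x 1] assms
    by (intro mult_mono) auto
  moreover have "norm ((A y \<bullet> (x - y)) *\<^sub>R B y) \<le> ?d * 1"
    unfolding norm_scaleR assms(4) using *[of "A y" 1 "x - y" ?d] assms
    by (intro mult_mono) auto
  moreover have "(A x \<bullet> x) *\<^sub>R B x - (A y \<bullet> y) *\<^sub>R B y =
      (A x \<bullet> x) *\<^sub>R B (x - y) + (A (x - y) \<bullet> x) *\<^sub>R B y + (A y \<bullet> (x - y)) *\<^sub>R B y"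
    using assms(1,2) by (simp add: linear_diff algebra_simps inner_diff)
  ultimately have "norm ((A x \<bullet> x) *\<^sub>R B x - (A y \<bullet> y) *\<^sub>R B y) \<le> 1 * ?d + ?d * 1 + ?d * 1"
    by (simp only: norm_triangle_mono)
  then show ?thesis by simp
qed

text \<open>For a function homogeneous of degree 4, scaling a vector by the power -1/4 of its
  positive value moves it to the level 1.\<close>

lemma powr_minus_quarter_power4: "0 < (t::real) \<Longrightarrow> (t powr (- 1 / 4)) ^ 4 = inverse t"
proof -
  assume "0 < t"
  then have "(t powr (- 1 / 4)) ^ 4 = t powr - 1" by (simp add: powr_power)
  then show ?thesis using \<open>0 < t\<close> by (simp add: powr_minus)
qed

section \<open>Linear algebra of a conjugation and the quartic Hamiltonian\<close>

text \<open>\<open>J\<close> is multiplication by \<open>\<i>\<close> and \<open>\<rho>\<close> a conjugation.\<close>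

locale antisymplectic_involution =
  fixes J \<rho> :: "'a::euclidean_space \<Rightarrow> 'a"
  assumes linear_J: "linear J" and linear_rho: "linear \<rho>"
    and J_J [simp]: "J (J x) = - x" and rho_rho [simp]: "\<rho> (\<rho> x) = x"
    and inner_J_J [simp]: "J x \<bullet> J y = x \<bullet> y" and inner_rho_rho [simp]: "\<rho> x \<bullet> \<rho> y = x \<bullet> y"
    and rho_J: "\<rho> (J x) = - J (\<rho> x)"
begin

lemmas J_linear = linear_add[OF linear_J] linear_diff[OF linear_J] linear_cmul[OF linear_J]
  linear_neg[OF linear_J]

lemmas rho_linear = linear_add[OF linear_rho] linear_diff[OF linear_rho]
  linear_cmul[OF linear_rho] linear_neg[OF linear_rho]

lemma inner_J: "J x \<bullet> y = - (x \<bullet> J y)"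
  using inner_J_J[of "J x" y] by simp

lemma inner_rho: "\<rho> x \<bullet> y = x \<bullet> \<rho> y"
  using inner_rho_rho[of x "\<rho> y"] by simp

lemma inner_J_self [simp]: "J x \<bullet> x = 0"
  using inner_J[of x x] by (simp add: inner_commute)

lemma inner_self_J [simp]: "x \<bullet> J x = 0"
  using inner_J_self[of x] by (simp only: inner_commute)

text \<open>\<open>J\<close> is skew, \<open>\<rho>\<close> is symmetric and the two anticommute, so
  their product is symmetric. Its quadratic form is the imaginary part of \<open>q\<close>.\<close>

lemma inner_J_rho: "J (\<rho> x) \<bullet> y = x \<bullet> J (\<rho> y)"
  by (simp add: inner_J inner_rho rho_J)

lemma norm_J [simp]: "norm (J x) = norm x"
  by (simp add: norm_eq_sqrt_inner)

lemma norm_rho [simp]: "norm (\<rho> x) = norm x"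
  by (simp add: norm_eq_sqrt_inner)

text \<open>\<open>Q z = |q z|\<^sup>2\<close> for the complex quadratic form \<open>q z = (\<rho> z \<bullet> z) + \<i> (J (\<rho> z) \<bullet> z)\<close>.\<close>

definition Q :: "'a \<Rightarrow> real" where
  "Q z = (\<rho> z \<bullet> z)\<^sup>2 + (J (\<rho> z) \<bullet> z)\<^sup>2"

definition H :: "real \<Rightarrow> 'a \<Rightarrow> real" where
  "H s z = (1 + s) * (z \<bullet> z)\<^sup>2 - s * Q z"

definition gradH :: "real \<Rightarrow> 'a \<Rightarrow> 'a" where
  "gradH s z = (4 * (1 + s) * (z \<bullet> z)) *\<^sub>R z
     - (4 * s) *\<^sub>R ((\<rho> z \<bullet> z) *\<^sub>R \<rho> z + (J (\<rho> z) \<bullet> z) *\<^sub>R J (\<rho> z))"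

text \<open>The factor 1/2 is the Reeb normalization: \<open>form z\<close> takes the value
  \<open>2 * H s z\<close> on \<open>J (gradH s z)\<close>, which is 2 on the level 1.\<close>

definition X :: "real \<Rightarrow> 'a \<Rightarrow> 'a" where
  "X s z = (1 / 2) *\<^sub>R J (gradH s z)"

definition form :: "'a \<Rightarrow> 'a \<Rightarrow> real" where
  "form z v = (J z \<bullet> v) / 2"

lemma X_eq: "X s z = (2 * (1 + s) * (z \<bullet> z)) *\<^sub>R J z
    - (2 * s) *\<^sub>R ((\<rho> z \<bullet> z) *\<^sub>R J (\<rho> z) - (J (\<rho> z) \<bullet> z) *\<^sub>R \<rho> z)"
  by (simp add: X_def gradH_def J_linear algebra_simps)

text \<open>Euler's identity in degree 4. It makes the gradient nonzero, and the radial direction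
  transverse to the level set, wherever \<open>H s\<close> does not vanish.\<close>

lemma gradH_inner_self: "gradH s z \<bullet> z = 4 * H s z"
  by (simp add: gradH_def H_def Q_def inner_diff_left inner_add_left power2_eq_square algebra_simps)

lemma H_scaleR: "H s (t *\<^sub>R z) = t ^ 4 * H s z"
  by (simp add: H_def Q_def rho_linear J_linear power2_eq_square power4_eq_xxxx algebra_simps)

text \<open>\<open>H s\<close> combines squares of the quadratic forms of three symmetric operators,
  the identity, \<open>\<rho>\<close> and \<open>J\<close> after \<open>\<rho>\<close>;
  \<open>e\<close> differentiates one such square.\<close>

lemma has_derivative_H: "(H s has_derivative (\<lambda>v. gradH s z \<bullet> v)) (at z)"
proof -
  have d: "(\<rho> has_derivative \<rho>) (at z)" "((\<lambda>z. J (\<rho> z)) has_derivative (\<lambda>z. J (\<rho> z))) (at z)"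
    using linear_imp_has_derivative linear_rho linear_compose[OF linear_rho linear_J]
    by (auto simp: o_def)
  have e: "((\<lambda>z. (A z \<bullet> z)\<^sup>2) has_derivative (\<lambda>v. 4 * (A z \<bullet> z) * (A z \<bullet> v))) (at z)"
    if "(A has_derivative A) (at z)" "\<And>x y. A x \<bullet> y = x \<bullet> A y" for A
  proof -
    have "((\<lambda>z. (A z \<bullet> z)\<^sup>2) has_derivative
        (\<lambda>v. of_nat 2 * (A z \<bullet> v + A v \<bullet> z) * (A z \<bullet> z) ^ (2 - 1))) (at z)"
      by (rule has_derivative_power[OF has_derivative_inner[OF that(1) has_derivative_ident]])
    moreover have "of_nat 2 * (A z \<bullet> v + A v \<bullet> z) * (A z \<bullet> z) ^ (2 - 1) =
        4 * (A z \<bullet> z) * (A z \<bullet> v)" for v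
      using that(2)[of v z] by (simp add: inner_commute)
    ultimately show ?thesis by (simp only:)
  qed
  have "(H s has_derivative (\<lambda>v. (1 + s) * (4 * (z \<bullet> z) * (z \<bullet> v)) -
      s * (4 * (\<rho> z \<bullet> z) * (\<rho> z \<bullet> v) + 4 * (J (\<rho> z) \<bullet> z) * (J (\<rho> z) \<bullet> v)))) (at z)"
    unfolding H_def[abs_def] Q_def
    by (intro has_derivative_diff has_derivative_mult_right has_derivative_add
        e[OF d(1) inner_rho] e[OF d(2) inner_J_rho] e[OF has_derivative_ident refl])
  then show ?thesis
    by (simp add: gradH_def inner_diff_left inner_add_left algebra_simps)
qed

lemma continuous_on_H: "continuous_on A (H s)"
  using has_derivative_H by (meson continuous_at_imp_continuous_on has_derivative_continuous)

lemma Q_le: "Q z \<le> (z \<bullet> z)\<^sup>2"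
proof -
  \<comment> \<open>\<open>\<rho> z\<close> and \<open>J (\<rho> z)\<close> are orthogonal of norm \<open>|z|\<close>, so this is Bessel's inequality.\<close>
  define w where "w = (\<rho> z \<bullet> z) *\<^sub>R \<rho> z + (J (\<rho> z) \<bullet> z) *\<^sub>R J (\<rho> z)"
  have "w \<bullet> w = Q z * (z \<bullet> z)" and "w \<bullet> z = Q z"
    by (simp_all add: w_def Q_def inner_add power2_eq_square algebra_simps inner_commute)
  then have "(Q z)\<^sup>2 \<le> Q z * (z \<bullet> z) * (z \<bullet> z)"
    using Cauchy_Schwarz_ineq[of w z] by simp
  moreover have "0 \<le> Q z" by (simp add: Q_def)
  ultimately show ?thesis
    by (cases "Q z = 0") (auto simp: power2_eq_square)
qed

text \<open>Splits off the round quartic. By \<open>Q_le\<close> the bracket is nonnegative, which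
  yields the bounds below.\<close>

lemma H_eq: "H s z = (z \<bullet> z)\<^sup>2 + s * ((z \<bullet> z)\<^sup>2 - Q z)"
  by (simp add: H_def algebra_simps)

lemma H_pos:
  assumes "\<bar>s\<bar> < 1" "z \<noteq> 0"
  shows "0 < H s z"
proof -
  have "0 \<le> (z \<bullet> z)\<^sup>2 - Q z" "(z \<bullet> z)\<^sup>2 - Q z \<le> (z \<bullet> z)\<^sup>2"
    using Q_le[of z] by (auto simp: Q_def)
  then have "\<bar>s * ((z \<bullet> z)\<^sup>2 - Q z)\<bar> \<le> \<bar>s\<bar> * (z \<bullet> z)\<^sup>2"
    by (simp add: abs_mult mult_left_mono)
  moreover have "\<bar>s\<bar> * (z \<bullet> z)\<^sup>2 < 1 * (z \<bullet> z)\<^sup>2"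
    using assms by (intro mult_strict_right_mono) auto
  ultimately show ?thesis by (simp add: H_eq)
qed

lemma H_zero [simp]: "H s 0 = 0"
  by (simp add: H_def Q_def linear_0[OF linear_rho] linear_0[OF linear_J])

lemma H_le_norm:
  assumes "0 \<le> s"
  shows "norm z ^ 4 \<le> H s z"
  using assms Q_le[of z] by (simp add: H_eq dot_square_norm)

text \<open>Confines the sublevel set, and with it every orbit on its boundary, to the unit ball,
  where the Lipschitz bound for \<open>X s\<close> is available.\<close>

lemma norm_le_1:
  assumes "0 \<le> s" "H s z \<le> 1"
  shows "norm z \<le> 1"
  using order_trans[OF H_le_norm[OF assms(1)] assms(2)] by (simp add: power_le_one_iff)

lemma smooth_on_H:
  fixes \<sigma> :: "'b::euclidean_space \<Rightarrow> real"
  assumes "open T" "smooth_on T \<sigma>" "smooth_on T f"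
  shows "smooth_on T (\<lambda>x. H (\<sigma> x) (f x))"
  unfolding H_def Q_def power2_eq_square
  by (intro smooth_on_diff smooth_on_add smooth_on_mult smooth_on_inner smooth_on_const assms
      smooth_on_bounded_linear[OF assms(1) linear_linear[THEN iffD2, OF linear_rho]]
      smooth_on_bounded_linear[OF assms(1) linear_linear[THEN iffD2, OF linear_J]])

section \<open>Tangent spaces and the Reeb vector field of the level set\<close>

lemma tangent_space_level:
  assumes "\<bar>s\<bar> < 1" "H s p = 1"
  shows "tangent_space {z. H s z = 1} p = {v. gradH s p \<bullet> v = 0}"
proof (intro set_eqI iffI CollectI)
  fix v assume "v \<in> tangent_space {z. H s z = 1} p"
  then obtain c e where c: "0 < e" "\<And>t. t \<in> {-e<..<e} \<Longrightarrow> H s (c t) = 1" "c 0 = p"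
    "(c has_vector_derivative v) (at (0::real))"
    unfolding tangent_space_def by blast
  have "((\<lambda>t. H s (c t)) has_derivative (\<lambda>t. gradH s p \<bullet> (t *\<^sub>R v))) (at 0)"
    using has_derivative_compose[OF c(4)[unfolded has_vector_derivative_def], of "H s", OF has_derivative_H]
    by (simp add: c(3))
  moreover have "((\<lambda>t. H s (c t)) has_derivative (\<lambda>t. 0)) (at 0)"
    using c by (intro has_derivative_transform_within_open[OF has_derivative_const[of "1::real" "at 0"],
          where s = "{-e<..<e}"]) auto
  ultimately show "gradH s p \<bullet> v = 0"
    using has_derivative_unique by (fastforce dest: fun_cong[of _ _ 1])
next
  fix v assume "v \<in> {v. gradH s p \<bullet> v = 0}"
  then have v: "gradH s p \<bullet> v = 0" by simp
  define l where "l t = p + t *\<^sub>R v" for t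
  \<comment> \<open>The power -1/4 below is smooth only where \<open>H s\<close> is
    positive.\<close>
  define T where "T = {t. 0 < H s (l t)}"
  have "continuous_on UNIV l" unfolding l_def by (intro continuous_intros)
  then have "continuous_on UNIV (\<lambda>t. H s (l t))"
    by (rule continuous_on_compose2[OF continuous_on_H]) auto
  then have T: "open T"
    unfolding T_def by (intro open_Collect_less continuous_on_const) auto
  have T0: "0 \<in> T" by (simp add: T_def l_def assms(2))
  have sm: "smooth_on T l"
    unfolding l_def
    by (intro smooth_on_add smooth_on_const T smooth_on_bounded_linear[OF T bounded_linear_scaleR_left]
        smooth_on_ident)
  \<comment> \<open>By homogeneity of degree 4 this is the radial projection of the line \<open>l\<close> to the level set.\<close>
  let ?c = "\<lambda>t. H s (l t) powr (- 1 / 4) *\<^sub>R l t"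
  have dl: "(l has_derivative (\<lambda>t. t *\<^sub>R v)) (at 0)"
    unfolding l_def by (auto intro!: derivative_eq_intros)
  have "((\<lambda>t. H s (l t)) has_derivative (\<lambda>t. gradH s p \<bullet> (t *\<^sub>R v))) (at 0)"
    using has_derivative_compose[OF dl has_derivative_H[of s "l 0"]] by (simp add: l_def)
  then have "((\<lambda>t. H s (l t)) has_real_derivative 0) (at 0)"
    using v by (simp add: has_field_derivative_def lambda_zero)
  \<comment> \<open>Since \<open>v\<close> is orthogonal to the gradient, the normalizing factor is
    stationary at 0, so the projected curve still has velocity \<open>v\<close>.\<close>
  then have "((\<lambda>t. H s (l t) powr (- 1 / 4)) has_real_derivative 0) (at 0)"
    using DERIV_chain2[where f = "\<lambda>y. y powr (- 1 / 4)" and g = "\<lambda>t. H s (l t)" and x = 0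
          and Db = 0 and s = UNIV, OF has_real_derivative_powr] T0
    by (simp add: T_def)
  then have "(?c has_vector_derivative v) (at 0)"
    unfolding has_vector_derivative_def has_field_derivative_def
    using has_derivative_scaleR[OF _ dl, of "\<lambda>t. H s (l t) powr (- 1 / 4)" "(*) 0"]
    by (simp add: l_def assms(2))
  moreover have "H s (?c t) = 1" if "t \<in> T" for t
  proof -
    have "0 < H s (l t)" using that by (simp add: T_def)
    then show ?thesis by (simp only: H_scaleR powr_minus_quarter_power4) simp
  qed
  moreover have "smooth_on T ?c"
    by (intro smooth_on_bounded_bilinear[OF T bounded_bilinear_scaleR] smooth_on_powr T sm smooth_on_H
        smooth_on_const) (simp add: T_def)
  ultimately show "v \<in> tangent_space {z. H s z = 1} p"
    by (intro tangent_spaceI[OF T T0, of ?c]) (auto simp: l_def assms(2))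
qed

text \<open>\<open>form\<close> is linear in the base point, hence its own derivative there;
  skewness of \<open>J\<close> merges the two halves into the standard symplectic form.\<close>

lemma ext_deriv_form: "ext_deriv form p u v = J u \<bullet> v"
proof -
  have "((\<lambda>x. form x w) has_derivative (\<lambda>x. form x w)) (at p)" for w
    unfolding form_def
    by (intro linear_imp_has_derivative linearI) (simp_all add: J_linear inner_add_left add_divide_distrib)
  then have "frechet_derivative (\<lambda>x. form x w) (at p) = (\<lambda>x. form x w)" for w
    by (rule frechet_derivative_eq)
  then show ?thesis
    using inner_J[of v u] by (simp add: ext_deriv_def form_def inner_commute)
qed

text \<open>The kernel condition says that \<open>J R\<close> is normal to the level set, hence a
  multiple of the gradient; the normalization and Euler's identity fix the multiple as -1/2.\<close>

lemma is_Reeb_vector_iff: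
  assumes "\<bar>s\<bar> < 1" "H s p = 1"
  shows "is_Reeb_vector form {z. H s z = 1} p R \<longleftrightarrow> R = X s p"
proof
  define g where "g = gradH s p"
  have gp: "g \<bullet> p = 4" by (simp add: g_def gradH_inner_self assms)
  then have "g \<bullet> g \<noteq> 0" by auto
  {
    assume "is_Reeb_vector form {z. H s z = 1} p R"
    then have R: "\<And>v. g \<bullet> v = 0 \<Longrightarrow> J R \<bullet> v = 0" "form p R = 1"
      unfolding is_Reeb_vector_def tangent_space_level[OF assms] ext_deriv_form g_def by auto
    \<comment> \<open>\<open>c *\<^sub>R g\<close> is the orthogonal projection of
      \<open>J R\<close> to the normal line. The remainder \<open>v\<close> is tangent, so it is
      orthogonal to \<open>J R\<close> as well as to \<open>g\<close>, hence to itself.\<close>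
    define c where "c = (J R \<bullet> g) / (g \<bullet> g)"
    define v where "v = J R - c *\<^sub>R g"
    have "g \<bullet> v = 0"
      using \<open>g \<bullet> g \<noteq> 0\<close> by (simp add: v_def c_def inner_diff_right inner_commute)
    then have "v \<bullet> v = 0"
      using R(1) by (simp add: v_def inner_diff_left)
    then have JR: "J R = c *\<^sub>R g" by (simp add: v_def)
    have "- (2 * form p R) = p \<bullet> J R" by (simp add: form_def inner_J)
    then have "c = - 1 / 2" using gp R(2) by (simp add: JR inner_commute)
    moreover have "R = - J (J R)" by simp
    ultimately show "R = X s p" by (simp only: JR X_def g_def J_linear) simp
  }
  assume "R = X s p"
  then have R: "R = (1 / 2) *\<^sub>R J g" by (simp add: X_def g_def)
  show "is_Reeb_vector form {z. H s z = 1} p R"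
    unfolding is_Reeb_vector_def tangent_space_level[OF assms] ext_deriv_form g_def[symmetric]
    using gp by (auto simp: R form_def J_linear inner_commute)
qed

section \<open>Symmetries and Lipschitz continuity of the Reeb field\<close>

text \<open>The gradient of the invariant function \<open>H s\<close> commutes with
  \<open>\<rho>\<close>, while \<open>J\<close> anticommutes with it. In the formula,
  \<open>\<rho>\<close> preserves the real part of \<open>q\<close> and negates the imaginary
  part.\<close>

lemma X_rho: "X s (\<rho> z) = - \<rho> (X s z)"
proof -
  have "J z \<bullet> \<rho> z = - (J (\<rho> z) \<bullet> z)"
    using inner_J[of z "\<rho> z"] inner_commute[of z "J (\<rho> z)"] by simp
  then show ?thesis
    using inner_commute[of z "\<rho> z"]
    by (simp add: X_eq rho_linear rho_J J_linear scaleR_diff_right scaleR_add_right)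
qed

text \<open>Each of the three cubic terms of \<open>X s\<close> has Lipschitz constant 3 on the unit
  ball; they enter with the factors \<open>2 * (1 + s)\<close> once and \<open>2 * s\<close>
  twice.\<close>

lemma X_lipschitz:
  assumes "norm x \<le> 1" "norm y \<le> 1"
  shows "norm (X s x - X s y) \<le> (6 * \<bar>1 + s\<bar> + 12 * \<bar>s\<bar>) * norm (x - y)"
proof -
  note lin = linear_id[unfolded id_def] linear_J linear_rho linear_compose[OF linear_rho linear_J, unfolded o_def]
  define a b c where
    "a = (x \<bullet> x) *\<^sub>R J x - (y \<bullet> y) *\<^sub>R J y" and
    "b = (\<rho> x \<bullet> x) *\<^sub>R J (\<rho> x) - (\<rho> y \<bullet> y) *\<^sub>R J (\<rho> y)" and
    "c = (J (\<rho> x) \<bullet> x) *\<^sub>R \<rho> x - (J (\<rho> y) \<bullet> y) *\<^sub>R \<rho> y"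
  have n: "norm a \<le> 3 * norm (x - y)" "norm b \<le> 3 * norm (x - y)" "norm c \<le> 3 * norm (x - y)"
    unfolding a_def b_def c_def
    using norm_quadratic_times_linear_diff_le[OF lin(1,2) _ _ assms]
      norm_quadratic_times_linear_diff_le[OF lin(3,4) _ _ assms]
      norm_quadratic_times_linear_diff_le[OF lin(4,3) _ _ assms] by simp_all
  have "X s x - X s y = (2 * (1 + s)) *\<^sub>R a - (2 * s) *\<^sub>R (b - c)"
    by (simp add: X_eq a_def b_def c_def algebra_simps)
  then have "norm (X s x - X s y) \<le> \<bar>2 * (1 + s)\<bar> * norm a + \<bar>2 * s\<bar> * norm (b - c)"
    using norm_triangle_ineq4[of "(2 * (1 + s)) *\<^sub>R a" "(2 * s) *\<^sub>R (b - c)"] by simp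
  also have "\<dots> \<le> \<bar>2 * (1 + s)\<bar> * (3 * norm (x - y)) + \<bar>2 * s\<bar> * (6 * norm (x - y))"
    using n norm_triangle_ineq4[of b c] by (intro add_mono mult_left_mono) auto
  also have "\<dots> = (6 * \<bar>1 + s\<bar> + 12 * \<bar>s\<bar>) * norm (x - y)"
    by (simp only: abs_mult abs_numeral) (simp add: algebra_simps)
  finally show ?thesis .
qed

text \<open>With u = c + \<i> d of modulus 1, \<open>w\<close> is u z, and the last two equations
  are the real and imaginary parts of q (u z) = u^2 q z.\<close>

lemma rotation_invariants:
  fixes c d :: real and z :: 'a
  assumes "c\<^sup>2 + d\<^sup>2 = 1"
  defines "w \<equiv> c *\<^sub>R z + d *\<^sub>R J z"
  shows "w \<bullet> w = z \<bullet> z"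
    and "\<rho> w \<bullet> w = (c\<^sup>2 - d\<^sup>2) * (\<rho> z \<bullet> z) - 2 * c * d * (J (\<rho> z) \<bullet> z)"
    and "J (\<rho> w) \<bullet> w = (c\<^sup>2 - d\<^sup>2) * (J (\<rho> z) \<bullet> z) + 2 * c * d * (\<rho> z \<bullet> z)"
proof -
  have e: "\<rho> z \<bullet> J z = - (J (\<rho> z) \<bullet> z)" "J z \<bullet> z = 0" "z \<bullet> J z = 0"
    using inner_J[of "\<rho> z" z] by simp_all
  have "w \<bullet> w = (c\<^sup>2 + d\<^sup>2) * (z \<bullet> z)"
    by (simp add: w_def inner_add_left inner_add_right e power2_eq_square algebra_simps)
  then show "w \<bullet> w = z \<bullet> z" using assms(1) by simp
  show "\<rho> w \<bullet> w = (c\<^sup>2 - d\<^sup>2) * (\<rho> z \<bullet> z) - 2 * c * d * (J (\<rho> z) \<bullet> z)"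
    by (simp add: w_def rho_linear rho_J inner_add_left inner_add_right inner_diff_left e
        power2_eq_square algebra_simps)
  show "J (\<rho> w) \<bullet> w = (c\<^sup>2 - d\<^sup>2) * (J (\<rho> z) \<bullet> z) + 2 * c * d * (\<rho> z \<bullet> z)"
    by (simp add: w_def rho_linear rho_J J_linear inner_add_left inner_add_right inner_diff_left e
        power2_eq_square algebra_simps)
qed

lemma H_rotation:
  assumes "c\<^sup>2 + d\<^sup>2 = (1::real)"
  shows "H s (c *\<^sub>R z + d *\<^sub>R J z) = H s z"
proof -
  have "((c\<^sup>2 - d\<^sup>2) * a - 2 * c * d * b)\<^sup>2 + ((c\<^sup>2 - d\<^sup>2) * b + 2 * c * d * a)\<^sup>2
      = (c\<^sup>2 + d\<^sup>2)\<^sup>2 * (a\<^sup>2 + b\<^sup>2)" for a b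
    by algebra
  then show ?thesis
    unfolding H_def Q_def rotation_invariants[OF assms] by (simp add: assms)
qed

text \<open>Equivariance of the Reeb field under the Hopf action, which preserves both
  \<open>H s\<close> and \<open>J\<close>.\<close>

lemma X_rotation:
  assumes "c\<^sup>2 + d\<^sup>2 = (1::real)"
  shows "X s (c *\<^sub>R z + d *\<^sub>R J z) = c *\<^sub>R X s z + d *\<^sub>R J (X s z)"
proof -
  define a b where "a = \<rho> z \<bullet> z" and "b = J (\<rho> z) \<bullet> z"
  define A B where "A = (c\<^sup>2 - d\<^sup>2) * a - 2 * c * d * b" and "B = (c\<^sup>2 - d\<^sup>2) * b + 2 * c * d * a"
  \<comment> \<open>With u = c + \<i> d and q = a + \<i> b, the left sides are the real part and
    minus the imaginary part of u^2 q times the conjugate of u, which is |u|^2 u q.\<close>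
  have "A * c + B * d = (c\<^sup>2 + d\<^sup>2) * (c * a - d * b)" "A * d - B * c = - (c\<^sup>2 + d\<^sup>2) * (c * b + d * a)"
    unfolding A_def B_def by algebra+
  then have e: "A * c + B * d = c * a - d * b" "A * d - B * c = - (c * b + d * a)"
    by (simp_all add: assms)
  have "X s (c *\<^sub>R z + d *\<^sub>R J z) =
      (2 * (1 + s) * (z \<bullet> z)) *\<^sub>R (c *\<^sub>R J z - d *\<^sub>R z)
      - (2 * s) *\<^sub>R (A *\<^sub>R (c *\<^sub>R J (\<rho> z) + d *\<^sub>R \<rho> z) - B *\<^sub>R (c *\<^sub>R \<rho> z - d *\<^sub>R J (\<rho> z)))"
    unfolding X_eq rotation_invariants[OF assms] A_def B_def a_def b_def
    by (simp add: rho_linear rho_J J_linear)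
  also have "A *\<^sub>R (c *\<^sub>R J (\<rho> z) + d *\<^sub>R \<rho> z) - B *\<^sub>R (c *\<^sub>R \<rho> z - d *\<^sub>R J (\<rho> z)) =
      (A * c + B * d) *\<^sub>R J (\<rho> z) + (A * d - B * c) *\<^sub>R \<rho> z"
    by (simp add: algebra_simps)
  also have "\<dots> = c *\<^sub>R (a *\<^sub>R J (\<rho> z) - b *\<^sub>R \<rho> z) + d *\<^sub>R J (a *\<^sub>R J (\<rho> z) - b *\<^sub>R \<rho> z)"
    unfolding e by (simp add: J_linear algebra_simps)
  finally show ?thesis
    by (simp add: X_eq a_def[symmetric] b_def[symmetric] J_linear algebra_simps)
qed

text \<open>If \<open>X s\<close> is \<open>k\<close> times the Hopf field at one point,
  equivariance carries this along the whole Hopf circle, which is then an integral curve of angular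
  speed \<open>k\<close>.\<close>

lemma rotation_solves:
  assumes "X s p = k *\<^sub>R J p"
  defines "\<gamma> \<equiv> \<lambda>t. cos (k * t) *\<^sub>R p + sin (k * t) *\<^sub>R J p"
  shows "(\<gamma> has_vector_derivative X s (\<gamma> t)) (at t)"
proof -
  have "X s (\<gamma> t) = cos (k * t) *\<^sub>R (k *\<^sub>R J p) + sin (k * t) *\<^sub>R (k *\<^sub>R (- p))"
    unfolding \<gamma>_def by (subst X_rotation) (simp_all add: assms(1) J_linear)
  then have "X s (\<gamma> t) = (k * cos (k * t)) *\<^sub>R J p - (k * sin (k * t)) *\<^sub>R p"
    by (simp add: mult.commute)
  moreover have "(\<gamma> has_vector_derivative (k * cos (k * t)) *\<^sub>R J p - (k * sin (k * t)) *\<^sub>R p) (at t)"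
    unfolding \<gamma>_def has_vector_derivative_def
    by (auto intro!: derivative_eq_intros simp: algebra_simps)
  ultimately show ?thesis by simp
qed

section \<open>Closed orbits and their periods\<close>

lemma periodic_orbit_iff:
  assumes "\<bar>s\<bar> < 1"
  shows "periodic_orbit form {z. H s z = 1} \<tau> \<gamma> \<longleftrightarrow>
    0 < \<tau> \<and> smooth_on UNIV \<gamma> \<and> (\<forall>t. \<gamma> (t + \<tau>) = \<gamma> t) \<and>
    (\<forall>t. H s (\<gamma> t) = 1 \<and> (\<gamma> has_vector_derivative X s (\<gamma> t)) (at t))"
proof -
  have "is_Reeb_vector form {z. H s z = 1} (\<gamma> t) (vector_derivative \<gamma> (at t)) \<longleftrightarrow>
      (\<gamma> has_vector_derivative X s (\<gamma> t)) (at t)"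
    if "smooth_on UNIV \<gamma>" "H s (\<gamma> t) = 1" for t
    unfolding is_Reeb_vector_iff[OF assms that(2)]
    using smooth_on_imp_differentiable[OF that(1), of t] vector_derivative_works
      vector_derivative_at by (metis UNIV_I)
  then show ?thesis unfolding periodic_orbit_def by auto
qed

text \<open>Where \<open>q\<close> vanishes, \<open>X s\<close> is 2 (1 + s) |z|^2 times the Hopf
  field, and the level condition reads sqrt (1 + s) |z|^2 = 1. The angular speed is therefore 2 sqrt
  (1 + s).\<close>

lemma periodic_orbit_null:
  assumes "0 \<le> s" "s < 1" and p: "p \<noteq> 0" "\<rho> p \<bullet> p = 0" "J (\<rho> p) \<bullet> p = 0"
  obtains \<gamma> where "periodic_orbit form {z. H s z = 1} (pi / sqrt (1 + s)) \<gamma>"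
proof -
  \<comment> \<open>Rescaling moves \<open>p\<close> to the level 1 and preserves the vanishing of
    the quadratic form.\<close>
  define l where "l = H s p powr (- 1 / 4)"
  define q where "q = l *\<^sub>R p"
  define k where "k = 2 * sqrt (1 + s)"
  have "0 < H s p" using H_pos[of s p] assms by simp
  then have Hq: "H s q = 1"
    by (simp only: q_def l_def H_scaleR powr_minus_quarter_power4) simp
  have null: "\<rho> q \<bullet> q = 0" "J (\<rho> q) \<bullet> q = 0"
    by (simp_all add: q_def rho_linear J_linear p)
  then have "(1 + s) * (q \<bullet> q)\<^sup>2 = 1" using Hq by (simp add: H_def Q_def)
  then have "sqrt ((1 + s) * (q \<bullet> q)\<^sup>2) = 1" by simp
  then have sq: "sqrt (1 + s) * (q \<bullet> q) = 1" by (simp add: real_sqrt_mult)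
  have "2 * (1 + s) * (q \<bullet> q) = 2 * (sqrt (1 + s) * sqrt (1 + s)) * (q \<bullet> q)"
    using assms by simp
  also have "\<dots> = k * (sqrt (1 + s) * (q \<bullet> q))" by (simp add: k_def)
  finally have "X s q = k *\<^sub>R J q" by (simp add: X_eq null sq)
  note sol = rotation_solves[OF this]
  have "k * (t + pi / sqrt (1 + s)) = k * t + 2 * pi" for t
    using assms by (simp add: k_def field_simps)
  then have "periodic_orbit form {z. H s z = 1} (pi / sqrt (1 + s))
      (\<lambda>t. cos (k * t) *\<^sub>R q + sin (k * t) *\<^sub>R J q)"
    using assms sol by (subst periodic_orbit_iff) (auto simp: smooth_on_rotation H_rotation Hq)
  then show ?thesis using that by blast
qed

lemma symmetric_period_ge:
  assumes s: "0 \<le> s" "s < 1"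
    and "symmetric_periodic_orbit form {z. H s z = 1} \<rho> \<tau> \<gamma>"
  shows "pi \<le> \<tau>"
proof -
  have \<tau>: "0 < \<tau>" and per: "\<And>t. \<gamma> (t + \<tau>) = \<gamma> t" and Hg: "\<And>t. H s (\<gamma> t) = 1"
    and sol: "\<And>t. (\<gamma> has_vector_derivative X s (\<gamma> t)) (at t)"
    and sym: "\<rho> ` range \<gamma> = range \<gamma>"
    using assms by (auto simp: symmetric_periodic_orbit_def periodic_orbit_iff)
  have le1: "norm z \<le> 1" if "H s z = 1" for z
    using norm_le_1[OF s(1)] that by simp
  obtain c where c: "\<rho> (\<gamma> 0) = \<gamma> c" using sym by blast
  \<comment> \<open>As \<open>\<rho>\<close> maps \<open>X s\<close> to \<open>- X s\<close>, reflection with time reversal is again a solution. It agrees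
    with \<open>\<gamma>\<close> at time \<open>c\<close>, so it is \<open>\<gamma>\<close>, and the midpoint \<open>\<gamma> (c / 2)\<close> is fixed by \<open>\<rho>\<close>.\<close>
  define \<sigma> where "\<sigma> t = \<rho> (\<gamma> (c - t))" for t
  have sol': "(\<sigma> has_vector_derivative X s (\<sigma> t)) (at t)" for t
  proof -
    have "((\<lambda>t. c - t) has_vector_derivative - 1) (at t)"
      by (auto intro!: derivative_eq_intros)
    from vector_diff_chain_at[OF this sol]
    have "((\<lambda>t. \<gamma> (c - t)) has_vector_derivative - X s (\<gamma> (c - t))) (at t)"
      by (simp add: o_def)
    from bounded_linear.has_vector_derivative[OF linear_rho[unfolded linear_conv_bounded_linear] this]
    show ?thesis by (simp add: \<sigma>_def[abs_def] X_rho rho_linear)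
  qed
  have n\<sigma>: "norm (\<sigma> t) \<le> 1" for t by (simp add: \<sigma>_def le1 Hg)
  have \<sigma>: "\<sigma> t = \<gamma> t" for t
    by (rule ode_unique[OF sol' sol X_lipschitz[OF n\<sigma> le1[OF Hg]], of c])
      (simp add: \<sigma>_def c)
  define p where "p = \<gamma> (c / 2)"
  have real: "\<rho> p = p" using \<sigma>[of "c / 2"] by (simp add: \<sigma>_def p_def)
  \<comment> \<open>At a fixed vector of \<open>\<rho>\<close> the terms in \<open>s\<close> cancel:
    \<open>p\<close> lies on the round sphere, and \<open>X s\<close> there is twice the Hopf
    field.\<close>
  have "H s p = (p \<bullet> p)\<^sup>2" by (simp add: H_def Q_def real algebra_simps)
  then have pp: "p \<bullet> p = 1"
    using Hg[of "c / 2"] by (intro power2_eq_imp_eq[of "p \<bullet> p" 1]) (simp_all add: p_def)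
  then have "X s p = 2 *\<^sub>R J p" by (simp add: X_eq real flip: scaleR_diff_left)
  note rot = rotation_solves[OF this]
  \<comment> \<open>The Hopf circle through \<open>p\<close>. A second use of uniqueness identifies
    it with \<open>\<gamma>\<close> shifted to start at \<open>p\<close>.\<close>
  define \<eta> where "\<eta> t = cos (2 * t) *\<^sub>R p + sin (2 * t) *\<^sub>R J p" for t
  have sol\<eta>: "(\<eta> has_vector_derivative X s (\<eta> t)) (at t)" for t
    using rot by (simp add: \<eta>_def[abs_def])
  have solp: "((\<lambda>t. \<gamma> (t + c / 2)) has_vector_derivative X s (\<gamma> (t + c / 2))) (at t)" for t
  proof -
    have "((\<lambda>t. t + c / 2) has_vector_derivative 1) (at t)"
      by (auto intro!: derivative_eq_intros)
    from vector_diff_chain_at[OF this sol] show ?thesis by (simp add: o_def)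
  qed
  have n\<eta>: "norm (\<eta> t) \<le> 1" for t
    using Hg[of "c / 2"] by (intro le1) (simp add: \<eta>_def H_rotation p_def)
  have \<eta>: "\<gamma> (t + c / 2) = \<eta> t" for t
    by (rule ode_unique[OF solp sol\<eta> X_lipschitz[OF le1[OF Hg] n\<eta>], of 0])
      (simp add: \<eta>_def p_def)
  have "\<eta> \<tau> = p" using \<eta>[of \<tau>] per[of "c / 2"] by (simp add: p_def add.commute)
  then have "\<eta> \<tau> \<bullet> p = 1" using pp by simp
  \<comment> \<open>Pairing with \<open>p\<close> kills the sine term, as \<open>J p\<close> is
    orthogonal to \<open>p\<close>. So \<open>\<tau>\<close> is an integer multiple of
    \<open>pi\<close>, and positivity makes the integer at least 1.\<close>
  then have "cos (2 * \<tau>) = 1" by (simp add: \<eta>_def inner_add_left pp)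
  then obtain m :: int where "2 * \<tau> = of_int m * (2 * pi)" 
    using cos_one_2pi_int by (metis mult.assoc mult.commute)
  then have m: "\<tau> = of_int m * pi" by simp
  then have "0 < m" using \<tau> by (simp add: zero_less_mult_iff)
  then have "1 * pi \<le> of_int m * pi" by (intro mult_right_mono) auto
  then show ?thesis using m by simp
qed

section \<open>Sublevel sets as starshaped perturbations of the ball\<close>

lemma frontier_sublevel:
  assumes "\<bar>s\<bar> < 1"
  shows "frontier {z. H s z \<le> 1} = {z. H s z = 1}"
proof -
  have "closed {z. H s z \<le> 1}"
    by (intro closed_Collect_le continuous_on_H continuous_on_const)
  moreover have "interior {z. H s z \<le> 1} = {z. H s z < 1}"
  proof (rule interior_unique)
    show "{z. H s z < 1} \<subseteq> {z. H s z \<le> 1}" by auto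
    show "open {z. H s z < 1}" by (intro open_Collect_less continuous_on_H continuous_on_const)
    fix T assume T: "T \<subseteq> {z. H s z \<le> 1}" "open T"
    show "T \<subseteq> {z. H s z < 1}"
    proof
      fix z assume z: "z \<in> T"
      \<comment> \<open>A point of level 1 leaves the sublevel set when scaled by any factor above
        1, so it is not interior.\<close>
      have "((\<lambda>t. t *\<^sub>R z) \<longlongrightarrow> 1 *\<^sub>R z) (at_right 1)" by (intro tendsto_intros)
      then have "eventually (\<lambda>t. t *\<^sub>R z \<in> T) (at_right 1)"
        using T(2) z by (simp add: topological_tendstoD)
      moreover have "eventually (\<lambda>t. 1 < t) (at_right (1::real))"
        by (simp add: eventually_at_right_less)
      ultimately have "eventually (\<lambda>t. t *\<^sub>R z \<in> T \<and> 1 < t) (at_right (1::real))"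
        by eventually_elim simp
      then obtain t where t: "t *\<^sub>R z \<in> T" "1 < t"
        using eventually_happens' trivial_limit_at_right_real by blast
      then have "t ^ 4 * H s z \<le> 1" using T(1) by (auto simp: H_scaleR)
      moreover have "1 < t ^ 4" using t(2) by simp
      ultimately have "H s z \<noteq> 1" "H s z \<le> 1" using T(1) z by auto
      then show "z \<in> {z. H s z < 1}" by simp
    qed
  qed
  ultimately show ?thesis by (auto simp: frontier_def)
qed

lemma starshaped_domain_sublevel:
  assumes "0 \<le> s" "s < 1"
  shows "starshaped_domain {z. H s z \<le> 1}"
proof -
  let ?K = "{z. H s z \<le> 1}"
  have s: "\<bar>s\<bar> < 1" using assms by simp
  have "closed ?K"
    by (intro closed_Collect_le continuous_on_H continuous_on_const)
  moreover have "?K \<subseteq> cball 0 1"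
    using norm_le_1[OF assms(1)] by auto
  ultimately have "compact ?K"
    using bounded_cball bounded_subset compact_eq_bounded_closed by blast
  moreover have "smooth_boundary ?K"
    unfolding smooth_boundary_def frontier_sublevel[OF s]
  proof (intro ballI exI conjI)
    fix p assume p: "p \<in> {z. H s z = 1}"
    \<comment> \<open>The origin, where the gradient vanishes, is removed; elsewhere the
      differential is tested on the radial vector \<open>x\<close>.\<close>
    show "open (- {0::'a})" by auto
    show "p \<in> - {0}" using p by auto
    show "smooth_on (- {0}) (\<lambda>z. H s z - 1)"
      by (intro smooth_on_diff smooth_on_H smooth_on_const smooth_on_ident) auto
    show "?K \<inter> - {0} = {x \<in> - {0}. H s x - 1 \<le> 0}" by auto
    fix x :: 'a assume "x \<in> - {0}"
    have "((\<lambda>z. H s z - 1) has_derivative (\<lambda>v. gradH s x \<bullet> v)) (at x)"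
      using has_derivative_diff[OF has_derivative_H has_derivative_const[of 1]] by simp
    then have "frechet_derivative (\<lambda>z. H s z - 1) (at x) x = 4 * H s x"
      by (simp add: frechet_derivative_eq gradH_inner_self)
    then show "frechet_derivative (\<lambda>z. H s z - 1) (at x) x \<noteq> 0"
      using H_pos[OF s, of x] \<open>x \<in> - {0}\<close> by auto
  qed
  moreover have "closed_segment 0 x \<subseteq> ?K" if "x \<in> ?K" for x
  proof
    fix y assume "y \<in> closed_segment 0 x"
    then obtain t where t: "0 \<le> t" "t \<le> 1" "y = t *\<^sub>R x" by (auto simp: in_segment)
    have "0 \<le> H s x" using H_pos[OF s, of x] by (cases "x = 0") auto
    then have "t ^ 4 * H s x \<le> 1 * 1"
      using that t by (intro mult_mono power_le_one) auto
    then show "y \<in> ?K" by (simp add: t H_scaleR)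
  qed
  \<comment> \<open>By Euler's identity the radial vector pairs to 4 with the gradient, so it is not
    tangent.\<close>
  moreover have "p \<notin> tangent_space {z. H s z = 1} p" if "H s p = 1" for p
    by (simp add: tangent_space_level[OF s that] gradH_inner_self that)
  ultimately show ?thesis
    unfolding starshaped_domain_def frontier_sublevel[OF s] by auto
qed

text \<open>By homogeneity the radial function is the power -1/4 of \<open>H s\<close>; it is
  jointly smooth because \<open>H s\<close> is positive off the origin for all parameters of modulus
  below 1.\<close>

lemma round_sphere_perturbation_sublevel: "round_sphere_perturbation 1 (\<lambda>s. {z. H s z \<le> 1})"
  unfolding round_sphere_perturbation_def
proof (intro conjI exI ballI)
  define r where "r s u = H s u powr (- 1 / 4)" for s and u :: 'a
  show "open (- {0::'a})" "sphere 0 1 \<subseteq> - {0::'a}" by auto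
  have "open ({- 1<..<1::real} \<times> - {0::'a})" by (intro open_Times) auto
  then show "smooth_on ({- 1<..<1} \<times> - {0}) (\<lambda>(s, u). r s u)"
    unfolding case_prod_beta r_def
    by (intro smooth_on_powr smooth_on_H smooth_on_bounded_linear[OF _ bounded_linear_fst]
        smooth_on_bounded_linear[OF _ bounded_linear_snd] smooth_on_ident) (auto intro!: H_pos)
  show "r 0 u = 1" if "u \<in> sphere 0 1" for u
    using that by (simp add: r_def H_def dot_square_norm)
  fix s :: real assume "s \<in> {- 1<..<1}"
  then have s: "\<bar>s\<bar> < 1" by auto
  have Hu: "0 < H s u" if "u \<in> sphere 0 1" for u
    using that by (intro H_pos[OF s]) auto
  show "0 < r s u" if "u \<in> sphere 0 1" for u using Hu[OF that] by (simp add: r_def)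
  have iff: "H s (t *\<^sub>R u) \<le> 1 \<longleftrightarrow> t \<le> r s u" if "u \<in> sphere 0 1" "0 \<le> t" for t u
  proof -
    have "H s (t *\<^sub>R u) \<le> 1 \<longleftrightarrow> t ^ 4 \<le> r s u ^ 4"
      unfolding r_def powr_minus_quarter_power4[OF Hu[OF that(1)]] H_scaleR
      using Hu[OF that(1)] by (simp add: field_simps)
    also have "\<dots> \<longleftrightarrow> t \<le> r s u"
      using that by (intro power_mono_iff) (auto simp: r_def)
    finally show ?thesis .
  qed
  show "{z. H s z \<le> 1} = {t *\<^sub>R u |t u. u \<in> sphere 0 1 \<and> 0 \<le> t \<and> t \<le> r s u}" (is "?L = ?R")
  proof (intro set_eqI iffI)
    fix z assume z: "z \<in> ?L"
    show "z \<in> ?R"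
    proof (cases "z = 0")
      case True
      \<comment> \<open>The origin determines no direction, so an arbitrary unit vector represents
        it with radius 0.\<close>
      obtain u :: 'a where "norm u = 1" using vector_choose_size[of 1] by auto
      then have "z = 0 *\<^sub>R u" "u \<in> sphere 0 1" "0 \<le> r s u" using True by (simp_all add: r_def)
      then show ?thesis by blast
    next
      case False
      have "sgn z \<in> sphere 0 1" "z = norm z *\<^sub>R sgn z"
        using False by (simp_all add: norm_sgn sgn_div_norm)
      moreover have "norm z \<le> r s (sgn z)"
        using iff[of "sgn z" "norm z"] z calculation by simp
      ultimately show ?thesis using norm_ge_zero by blast
    qed
  next
    fix z assume "z \<in> ?R"
    then show "z \<in> ?L" using iff by auto
  qed
qed auto

lemma rho_image_sublevel: "\<rho> ` {z. H s z \<le> 1} = {z. H s z \<le> 1}"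
proof -
  have "J z \<bullet> \<rho> z = - (J (\<rho> z) \<bullet> z)" for z
    using inner_J[of z "\<rho> z"] inner_commute[of z "J (\<rho> z)"] by simp
  then have "H s (\<rho> z) = H s z" for z
    by (simp add: H_def Q_def inner_commute[of z "\<rho> z"])
  then show ?thesis by (auto intro!: image_eqI[where x = "\<rho> _"])
qed

section \<open>Lower bound for the symmetric ratio\<close>

text \<open>The orbit over a null vector bounds the systole above by
  \<open>pi / sqrt (1 + s)\<close>, while symmetric periods are at least \<open>pi\<close>; the
  ratio is therefore at least \<open>sqrt (1 + s)\<close>.\<close>

lemma symmetric_ratio_gt_1:
  assumes s: "0 < s" "s < 1" and p: "p \<noteq> 0" "\<rho> p \<bullet> p = 0" "J (\<rho> p) \<bullet> p = 0"
  shows "1 < symmetric_ratio form {z. H s z = 1} \<rho>"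
proof -
  let ?S = "{z. H s z = 1}" and ?T = "pi / sqrt (1 + s)"
  have T: "0 < ?T" "1 < pi / ?T" using s by simp_all
  obtain \<gamma> where "periodic_orbit form ?S ?T \<gamma>" using periodic_orbit_null[OF _ s(2) p] s by auto
  then have "systole form ?S \<le> ennreal ?T"
    unfolding systole_def by (intro INF_lower) auto
  moreover have "ennreal pi \<le> symmetric_systole form ?S \<rho>"
    unfolding symmetric_systole_def
    using symmetric_period_ge[OF less_imp_le[OF s(1)] s(2)] by (auto intro!: INF_greatest ennreal_leI)
  ultimately have "ennreal pi / ennreal ?T \<le> symmetric_ratio form ?S \<rho>"
    unfolding symmetric_ratio_def divide_ennreal_def
    by (intro mult_mono ennreal_inverse_antimono) auto
  moreover have "1 < ennreal pi / ennreal ?T"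
    using T by (subst divide_ennreal) auto
  ultimately show ?thesis by (rule less_le_trans[rotated])
qed

end

section \<open>Complex coordinates and a zero of the quadratic form\<close>

definition mult_i :: "complex ^ 'n \<Rightarrow> complex ^ 'n" where
  "mult_i z = (\<chi> j. \<i> * z $ j)"

lemma antisymplectic_involution_rho: "antisymplectic_involution mult_i (rho \<theta>)"
  for \<theta> :: "real ^ 'n"
proof (rule antisymplectic_involution.intro)
  show "linear (mult_i :: complex ^ 'n \<Rightarrow> _)"
    by (intro linearI) (auto simp: mult_i_def vec_eq_iff algebra_simps)
  show "linear (rho \<theta>)"
    by (intro linearI) (auto simp: rho_def vec_eq_iff algebra_simps)
  show "mult_i (mult_i x) = - x" for x :: "complex ^ 'n"
    by (simp add: mult_i_def vec_eq_iff flip: mult.assoc)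
  have "cis a * (cnj (cis a) * z) = z" for a z
    by (simp add: cis_cnj cis_mult flip: mult.assoc)
  then show "rho \<theta> (rho \<theta> x) = x" for x :: "complex ^ 'n"
    by (simp add: rho_def vec_eq_iff)
  show "mult_i x \<bullet> mult_i y = x \<bullet> y" for x y :: "complex ^ 'n"
    by (simp add: mult_i_def inner_vec_def inner_complex_def add.commute)
  have "(cis a * cnj z) \<bullet> (cis a * cnj w) = z \<bullet> w" for a z w
  proof -
    have "(cis a * cnj z) \<bullet> (cis a * cnj w) = ((cos a)\<^sup>2 + (sin a)\<^sup>2) * (z \<bullet> w)"
      unfolding inner_complex_def
      by (simp add: power2_eq_square algebra_simps del: sin_cos_squared_add2 sin_cos_squared_add3)
    then show ?thesis by simp
  qed
  then show "rho \<theta> x \<bullet> rho \<theta> y = x \<bullet> y" for x y :: "complex ^ 'n"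
    by (simp add: rho_def inner_vec_def)
  show "rho \<theta> (mult_i x) = - mult_i (rho \<theta> x)" for x :: "complex ^ 'n"
    by (simp add: rho_def mult_i_def vec_eq_iff)
qed

interpretation rho: antisymplectic_involution mult_i "rho \<theta>" for \<theta> :: "real ^ 'n"
  by (rule antisymplectic_involution_rho)

lemma lambda0_eq_form: "lambda0 = rho.form"
  by (intro ext) (simp add: lambda0_def rho.form_def inner_vec_def inner_complex_def mult_i_def
      algebra_simps)

text \<open>With one coordinate |q z| = |z|^2, so a nonzero zero of \<open>q\<close> takes two:
  their contributions are made 1 and -1.\<close>

lemma ex_null_vector:
  fixes \<theta> :: "real ^ 'n"
  assumes "2 \<le> CARD('n)"
  obtains p :: "complex ^ 'n"
  where "p \<noteq> 0" "rho \<theta> p \<bullet> p = 0" "mult_i (rho \<theta> p) \<bullet> p = 0"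
proof -
  obtain j k :: 'n where jk: "j \<noteq> k"
    using assms card_2_iff' ex_card by (metis UNIV_I card_le_Suc0_iff_eq finite not_less_eq_eq numeral_2_eq_2)
  \<comment> \<open>The half angles compensate the phases of \<open>rho \<theta>\<close>: the entry
    at \<open>j\<close> is fixed by it, and the factor \<open>\<i>\<close> makes the entry at
    \<open>k\<close> change sign.\<close>
  define p :: "complex ^ 'n" where
    "p = (\<chi> l. if l = j then cis (\<theta> $ j / 2) else if l = k then \<i> * cis (\<theta> $ k / 2) else 0)"
  have half: "cis a * cnj (cis (a / 2)) = cis (a / 2)" for a
    by (simp add: cis_cnj cis_mult)
  have rp: "rho \<theta> p = (\<chi> l. if l = j then cis (\<theta> $ j / 2) else if l = k then - \<i> * cis (\<theta> $ k / 2) else 0)"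
    using half by (auto simp: rho_def p_def vec_eq_iff mult.left_commute)
  have sum2: "(\<Sum>l\<in>UNIV. f l) = f j + f k" if "\<And>l. l \<noteq> j \<Longrightarrow> l \<noteq> k \<Longrightarrow> f l = 0" for f :: "'n \<Rightarrow> real"
    using that jk by (subst sum.mono_neutral_right[of UNIV "{j, k}"]) auto
  have "rho \<theta> p \<bullet> p = 0"
    unfolding rp inner_vec_def
    by (subst sum2, use jk in \<open>auto simp: p_def inner_complex_def\<close>)
      (use sin_cos_squared_add3[of "\<theta> $ k / 2"] in linarith)
  moreover have "mult_i (rho \<theta> p) \<bullet> p = 0"
    unfolding rp inner_vec_def mult_i_def
    by (subst sum2, use jk in \<open>auto simp: p_def inner_complex_def\<close>)
  moreover have "p $ j \<noteq> 0" by (simp add: p_def)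
  then have "p \<noteq> 0" by auto
  ultimately show ?thesis using that by blast
qed

theorem mainTheorem3:
  fixes \<theta> :: "real ^ 'n"
  assumes "2 \<le> CARD('n)"
  shows "\<exists>\<delta> (K :: real \<Rightarrow> (complex ^ 'n) set).
           round_sphere_perturbation \<delta> K \<and>
           (\<forall>s\<in>{0<..<\<delta>}. starshaped_domain (K s) \<and> rho \<theta> ` K s = K s \<and>
              1 < symmetric_ratio lambda0 (frontier (K s)) (rho \<theta>))"
proof (intro exI conjI ballI)
  show "round_sphere_perturbation 1 (\<lambda>s. {z. rho.H \<theta> s z \<le> 1})"
    by (rule rho.round_sphere_perturbation_sublevel)
  fix s :: real assume s: "s \<in> {0<..<1}"
  show "starshaped_domain {z. rho.H \<theta> s z \<le> 1}"
    using s by (intro rho.starshaped_domain_sublevel) auto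
  show "rho \<theta> ` {z. rho.H \<theta> s z \<le> 1} = {z. rho.H \<theta> s z \<le> 1}"
    by (rule rho.rho_image_sublevel)
  obtain p where "p \<noteq> 0" "rho \<theta> p \<bullet> p = 0" "mult_i (rho \<theta> p) \<bullet> p = 0"
    using ex_null_vector[OF assms] .
  then show "1 < symmetric_ratio lambda0 (frontier {z. rho.H \<theta> s z \<le> 1}) (rho \<theta>)"
    using s rho.symmetric_ratio_gt_1[of s p \<theta>]
    by (simp add: rho.frontier_sublevel lambda0_eq_form)
qed

end
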